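(* Let $n \geq 4$ be an even integer. For any APN function $F \colon \mathbb{F}_2^n \to \mathbb{F}_2^n$, we have $\mathcal{NL}(F) \geq 3$.
   Context: A function $F\colon \mathbb{F}_2^n \to \mathbb{F}_2^n$ is almost perfect nonlinear (APN) if for every nonzero $a \in \mathbb{F}_2^n$ and every $b \in \mathbb{F}_2^n$, the equation $F(x)+F(x+a)=b$ has at most $2$ solutions $x \in \mathbb{F}_2^n$. For a Boolean function $f\colon \mathbb{F}_2^n\to\mathbb{F}_2$, the nonlinearity $\mathcal{NL}(f)$ is the minimum Hamming distance between $f$ and an affine function $\mathbb{F}_2^n \to \mathbb{F}_2$; equivalently $\mathcal{NL}(f) = 2^{n-1}-\frac12\max_{u\in\mathbb{F}_2^n}|W_f(u)|$, where $W_f(u)=\sum_{x\in\mathbb{F}_2^n}(-1)^{f(x)+x\cdot u}$ and $\cdot$ is the standard dot product. For $F \colon \mathbb{F}_2^n\to\mathbb{F}_2^n$, the nonlinearity is $\mathcal{NL}(F)=\min_{v\in\mathbb{F}_2^n\setminus\{0\}}\mathcal{NL}(v\cdot F)$, where $(v\cdot F)(x)=v\cdot F(x)$. Equivalently, $\mathcal{NL}(F)=2^{n-1}-\frac12\max_{u,v\in\mathbb{F}_2^n,\,v\neq0}|W_F(u,v)|$ with $W_F(u,v)=\sum_{x\in\mathbb{F}_2^n}(-1)^{u\cdot x+v\cdot F(x)}$. *)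

theory Defs
  imports "HOL-Analysis.Cartesian_Space" "HOL-Library.Z2"
begin

text \<open>The space $\mathbb{F}_2^n$ is the type \<^typ>\<open>bit ^ 'n\<close> with \<open>n = CARD('n)\<close>. The instance
  below makes it a finite type, so that \<open>card\<close> and \<open>Min\<close> range over finite sets throughout.\<close>

instance bit :: finite
proof
  have "(UNIV :: bit set) = {0, 1}"
    using bit.exhaust by auto
  then show "finite (UNIV :: bit set)"
    by (rule ssubst) (intro finite.intros)
qed

definition apn :: "(bit ^ 'n \<Rightarrow> bit ^ 'n) \<Rightarrow> bool" where
  "apn F \<longleftrightarrow> (\<forall>a b. a \<noteq> 0 \<longrightarrow> card {x. F x + F (x + a) = b} \<le> 2)"

definition dot :: "bit ^ 'n \<Rightarrow> bit ^ 'n \<Rightarrow> bit" where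
  "dot u x = (\<Sum>i\<in>UNIV. u $ i * x $ i)"

definition hamming_dist :: "(bit ^ 'n \<Rightarrow> bit) \<Rightarrow> (bit ^ 'n \<Rightarrow> bit) \<Rightarrow> nat" where
  "hamming_dist f g = card {x. f x \<noteq> g x}"

definition affine_fun :: "(bit ^ 'n \<Rightarrow> bit) \<Rightarrow> bool" where
  "affine_fun g \<longleftrightarrow> (\<exists>L c. Vector_Spaces.linear (*s) (*) L \<and> g = (\<lambda>x. L x + c))"

lemma affine_fun_iff_dot:
  "affine_fun g \<longleftrightarrow> (\<exists>u c. g = (\<lambda>x. dot u x + c))"
proof
  assume "affine_fun g"
  then obtain L c where L: "Vector_Spaces.linear (*s) (*) L" and g: "g = (\<lambda>x. L x + c)"
    by (auto simp: affine_fun_def)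
  interpret L: Vector_Spaces.linear "(*s)" "(*)" L by (rule L)
  have "L x = dot (\<chi> i. L (axis i 1)) x" for x
  proof -
    have "L x = L (\<Sum>i\<in>UNIV. x $ i *s axis i 1)"
      by (simp add: basis_expansion)
    also have "\<dots> = dot (\<chi> i. L (axis i 1)) x"
      unfolding L.sum L.scale dot_def vec_lambda_beta by (rule sum.cong, rule refl, rule mult.commute)
    finally show ?thesis .
  qed
  then have "g = (\<lambda>x. dot (\<chi> i. L (axis i 1)) x + c)"
    unfolding g by (intro ext arg_cong2[where f = plus] refl)
  then show "\<exists>u c. g = (\<lambda>x. dot u x + c)" by blast
next
  assume "\<exists>u c. g = (\<lambda>x. dot u x + c)"
  then obtain u c where g: "g = (\<lambda>x. dot u x + c)" by blast
  have add: "dot u (x + y) = dot u x + dot u y" for x y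
    by (simp only: dot_def vector_add_component distrib_left sum.distrib)
  have scale: "dot u (k *s x) = k * dot u x" for k x
    by (simp only: dot_def vector_smult_component sum_distrib_left mult.left_commute)
  have "Vector_Spaces.linear (*s) (*) (dot u)"
    unfolding Vector_Spaces.linear_iff
    using vec.vector_space_axioms vector_space_over_itself.vector_space_axioms add scale
    by blast
  with g show "affine_fun g" unfolding affine_fun_def by blast
qed

definition nonlinearity_bool :: "(bit ^ 'n \<Rightarrow> bit) \<Rightarrow> nat" where
  "nonlinearity_bool f = (MIN g\<in>{g. affine_fun g}. hamming_dist f g)"

definition nonlinearity :: "(bit ^ 'n \<Rightarrow> bit ^ 'n) \<Rightarrow> nat" where
  "nonlinearity F = (MIN v\<in>UNIV - {0}. nonlinearity_bool (\<lambda>x. dot v (F x)))"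

end

theory Submission
  imports Defs "HOL-Library.Product_Plus"
begin

text \<open>
  Suppose that a component \<open>v \<cdot> F\<close> of the APN function \<open>F\<close> agrees with an affine function
  outside two points \<open>p \<noteq> q\<close>. Adding to \<open>F\<close> the affine function, times a vector \<open>y\<close> with
  \<open>v \<cdot> y = 1\<close>, gives a function whose values off \<open>p, q\<close> lie in the hyperplane \<open>v\<^sup>\<bottom>\<close>; the APN property
  says that no two-dimensional flat has value sum zero, and the addition keeps this. The values at
  \<open>p\<close> and \<open>q\<close> can then be changed so that all values lie in \<open>v\<^sup>\<bottom>\<close> and still no flat containing
  both or neither of \<open>p, q\<close> has value sum zero (\<open>punctured_sidon_graph_of_apn\<close>): on the other points
  the derivative in direction \<open>p + q\<close> misses some vector of \<open>v\<^sup>\<bottom>\<close>, which is taken as the difference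
  of the two new values. Hence every flat with value sum zero contains exactly one of \<open>p, q\<close>, and it
  remains to refute the existence of such a function \<open>G\<close>. Write \<open>Q = 2\<^sup>n\<close> and \<open>s\<^sup>2 = Q\<close>; that \<open>n\<close> is even
  makes \<open>s\<close> an integer.

  Let \<open>W(u, w)\<close> be the Walsh transform of \<open>G\<close>, signed so as to count flats through \<open>p\<close>, and take
  \<open>w \<notin> {0, v}\<close>. The derivative of \<open>G\<close> in direction \<open>p + q\<close> is two-to-one onto \<open>v\<^sup>\<bottom>\<close>, so
  \<open>w \<cdot> G\<close> has a balanced derivative and \<open>W(u, w)\<close> is divisible by four (\<open>four_dvd_walsh\<close>).
  The key is the polynomial \<open>(W\<^sup>2 - Q) ((W - 4)\<^sup>2 - Q)\<close>. Its roots \<open>\<plusminus> s, 4 \<plusminus> s\<close> form two pairs of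
  neighbouring multiples of four, so it is nonnegative at every multiple of four. The first four
  moments of \<open>W\<close> count flats with value sum zero, those through \<open>p\<close> in the third moment and those
  through \<open>p\<close> or \<open>q\<close> in the fourth; if, as may be assumed by symmetry, at least as many pass through
  \<open>p\<close> as through \<open>q\<close>, then the sum of the polynomial over all \<open>(u, w)\<close> with \<open>w \<notin> {0, v}\<close> is at most
  zero. So every such \<open>W(u, w)\<close> is one of \<open>\<plusminus> s, 4 \<plusminus> s\<close> (\<open>walsh_values\<close>).

  As for bent functions with too many components, divisibility now gives a contradiction: over \<open>w\<close> in a
  complement of the line spanned by \<open>v\<close>, the sums of \<open>W(0, w)\<close> and of its square are divisible by
  \<open>Q / 2\<close> and \<open>Q\<close>, and these two congruences are incompatible as soon as eight divides \<open>s\<close>, that is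
  for \<open>n \<ge> 6\<close> (\<open>not_8_dvd_sqrt\<close>). For \<open>n = 4\<close> the fourteen points of the graph off \<open>p, q\<close> are too many by
  a sphere-packing count: some six of them sum to zero, and modulo these the other eight would be a
  single-error-correcting code that violates the Hamming bound (\<open>dimension_neq_4\<close>).
\<close>

section \<open>Characters of binary vector spaces\<close>

lemma bit_vec_add_self [simp]: "(x :: bit ^ 'n) + x = 0"
  by (simp add: vec_eq_iff)

lemma bit_vec_add_left_self [simp]: "(x :: bit ^ 'n) + (x + y) = y"
  by (simp flip: add.assoc)

lemma bit_vec_add_eq_0_iff [simp]: "(x :: bit ^ 'n) + y = 0 \<longleftrightarrow> x = y"
  by (metis add.right_neutral bit_vec_add_left_self bit_vec_add_self)

lemma bit_vec_swap: "(x :: bit ^ 'n) + y = z \<longleftrightarrow> y = x + z"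
  by (metis bit_vec_add_left_self)

lemma dot_add_left: "dot (u + w) x = dot u x + dot w x"
  by (simp only: dot_def vector_add_component distrib_right sum.distrib)

lemma dot_add_right: "dot u (x + y) = dot u x + dot u y"
  by (simp only: dot_def vector_add_component distrib_left sum.distrib)

lemma dot_commute: "dot u x = dot x u"
  unfolding dot_def by (rule sum.cong) (simp_all only: mult.commute)

lemma dot_zero [simp]: "dot 0 x = 0" "dot u 0 = 0"
  by (simp_all add: dot_def)

lemma dot_scale_right: "dot u (k *s x) = k * dot u x"
  by (simp only: dot_def vector_smult_component sum_distrib_left mult.left_commute)

text \<open>Nondegeneracy: some character takes the value \<open>-1\<close> on a given nonzero vector. This
  is what makes the character sums below vanish.\<close>

lemma ex_dot_eq_1:
  fixes x :: "bit ^ 'n"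
  assumes "x \<noteq> 0"
  shows "\<exists>u. dot u x = 1"
proof -
  obtain i where i: "x $ i \<noteq> 0"
    using assms by (auto simp: vec_eq_iff)
  have "dot (axis i 1) x = (\<Sum>j\<in>UNIV. if j = i then x $ j else 0)"
    unfolding dot_def axis_def by (rule sum.cong) auto
  then have "dot (axis i 1) x = x $ i" by simp
  with i show ?thesis by auto
qed

lemma card_bit [simp]: "CARD(bit) = 2"
proof -
  have "(UNIV :: bit set) = {0, 1}" using bit.exhaust by auto
  then show ?thesis by (metis card_2_iff zero_neq_one)
qed

lemma card_hyperplane:
  fixes v :: "bit ^ 'n"
  assumes "v \<noteq> 0"
  shows "2 * card {z. dot v z = 0} = CARD(bit ^ 'n)"
proof -
  let ?H = "{z. dot v z = 0}"
  obtain y where "dot y v = 1"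
    using ex_dot_eq_1[OF assms] by blast
  then have y: "dot v y = 1" by (simp add: dot_commute)
  have "card (UNIV - ?H) = card ?H"
    by (rule bij_betw_same_card[of "\<lambda>z. z + y"], rule bij_betw_byWitness[of _ "\<lambda>z. z + y"])
      (auto simp: dot_add_right y ac_simps)
  then show ?thesis
    using card_Diff_subset[of ?H UNIV] card_mono[of UNIV ?H] by simp
qed

definition chi :: "bit \<Rightarrow> int" where
  "chi b = (if b = 0 then 1 else -1)"

lemma chi_0 [simp]: "chi 0 = 1" and chi_1 [simp]: "chi 1 = -1"
  by (simp_all add: chi_def)

lemma chi_add: "chi (a + b) = chi a * chi b"
  by (cases a; cases b) (simp_all add: chi_def)

lemma sum_shift:
  fixes a :: "bit ^ 'n"
  shows "(\<Sum>x\<in>UNIV. f (x + a)) = (\<Sum>x\<in>UNIV. f x)"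
  by (rule sum.reindex_bij_witness[of _ "\<lambda>x. x + a" "\<lambda>x. x + a"]) (auto simp: ac_simps)

lemma sum_chi_dot:
  fixes x :: "bit ^ 'n"
  shows "(\<Sum>u\<in>UNIV. chi (dot u x)) = (if x = 0 then 2 ^ CARD('n) else 0)"
proof (cases "x = 0")
  case False
  then obtain a where a: "dot a x = 1" using ex_dot_eq_1 by blast
  have "(\<Sum>u\<in>UNIV. chi (dot u x)) = (\<Sum>u\<in>UNIV. chi (dot (u + a) x))"
    by (rule sum_shift[symmetric])
  also have "\<dots> = - (\<Sum>u\<in>UNIV. chi (dot u x))"
    by (simp only: dot_add_left chi_add a chi_1 mult_minus1_right sum_negf)
  finally show ?thesis using False by simp
qed simp

text \<open>Orthogonality turns a sum over all characters into a count of solutions of \<open>h i = 0\<close>.\<close>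

lemma sum_sum_chi_dot:
  fixes h :: "'i \<Rightarrow> bit ^ 'n"
  assumes "finite I"
  shows "(\<Sum>u\<in>UNIV. \<Sum>i\<in>I. chi (dot u (h i))) = 2 ^ CARD('n) * int (card {i \<in> I. h i = 0})"
proof -
  have "(\<Sum>u\<in>UNIV. \<Sum>i\<in>I. chi (dot u (h i))) = (\<Sum>i\<in>I. if h i = 0 then 2 ^ CARD('n) else 0)"
    by (subst sum.swap) (simp add: sum_chi_dot)
  also have "\<dots> = (\<Sum>i\<in>{i \<in> I. h i = 0}. 2 ^ CARD('n))"
    using assms by (rule sum.inter_filter[symmetric])
  finally show ?thesis by simp
qed

text \<open>The character of the product space with index \<open>r\<close>, at a point of the space in which graphs
  live.\<close>

definition pair_chi :: "(bit ^ 'n) \<times> (bit ^ 'n) \<Rightarrow> (bit ^ 'n) \<times> (bit ^ 'n) \<Rightarrow> int" where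
  "pair_chi r z = chi (dot (fst r) (fst z)) * chi (dot (snd r) (snd z))"

lemma pair_chi_add: "pair_chi r (y + z) = pair_chi r y * pair_chi r z"
  by (simp only: pair_chi_def dot_add_right chi_add fst_add snd_add mult_ac)

lemma sum_pair_chi:
  fixes z :: "(bit ^ 'n) \<times> (bit ^ 'n)"
  shows "(\<Sum>r\<in>UNIV. pair_chi r z) = (if z = 0 then (2 ^ CARD('n))\<^sup>2 else 0)"
proof -
  have "(\<Sum>r\<in>UNIV. pair_chi r z) =
      (\<Sum>u\<in>UNIV. chi (dot u (fst z))) * (\<Sum>w\<in>UNIV. chi (dot w (snd z)))"
    unfolding sum_product sum.cartesian_product pair_chi_def UNIV_Times_UNIV
    by (rule sum.cong) auto
  then show ?thesis
    by (auto simp: sum_chi_dot power2_eq_square prod_eq_iff)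
qed

lemma sum_sum_pair_chi:
  fixes h :: "'i \<Rightarrow> (bit ^ 'n) \<times> (bit ^ 'n)"
  assumes "finite I"
  shows "(\<Sum>r\<in>UNIV. \<Sum>i\<in>I. pair_chi r (h i)) = (2 ^ CARD('n))\<^sup>2 * int (card {i \<in> I. h i = 0})"
proof -
  have "(\<Sum>r\<in>UNIV. \<Sum>i\<in>I. pair_chi r (h i)) = (\<Sum>i\<in>I. if h i = 0 then (2 ^ CARD('n))\<^sup>2 else 0)"
    by (subst sum.swap) (simp add: sum_pair_chi)
  also have "\<dots> = (\<Sum>i\<in>{i \<in> I. h i = 0}. (2 ^ CARD('n))\<^sup>2)"
    using assms by (rule sum.inter_filter[symmetric])
  finally show ?thesis by simp
qed

text \<open>Parseval: the second moment of the component sums counts the collisions of \<open>h\<close>.\<close>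

lemma sum_square_chi_dot:
  fixes h :: "'i::finite \<Rightarrow> bit ^ 'n"
  shows "(\<Sum>w\<in>UNIV. (\<Sum>x\<in>UNIV. chi (dot w (h x)))\<^sup>2)
    = 2 ^ CARD('n) * int (card {(x, y). h x = h y})"
proof -
  have "(\<Sum>x\<in>UNIV. chi (dot w (h x)))\<^sup>2 = (\<Sum>t\<in>UNIV. chi (dot w (h (fst t) + h (snd t))))" for w
    unfolding power2_eq_square sum_product sum.cartesian_product UNIV_Times_UNIV
    by (rule sum.cong) (auto simp only: dot_add_right chi_add split_def)
  then have "(\<Sum>w\<in>UNIV. (\<Sum>x\<in>UNIV. chi (dot w (h x)))\<^sup>2)
      = 2 ^ CARD('n) * int (card {t \<in> UNIV. h (fst t) + h (snd t) = 0})"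
    by (simp only: sum_sum_chi_dot finite)
  also have "{t \<in> UNIV. h (fst t) + h (snd t) = 0} = {(x, y). h x = h y}"
    by auto
  finally show ?thesis .
qed

lemma prod_consecutive_nonneg: "0 \<le> (a :: int) * (a - 1)"
  by (metis diff_ge_0_iff_ge int_one_le_iff_zero_less linorder_not_less mult_nonneg_nonneg
      mult_nonpos_nonpos order.strict_implies_order le_cases zle_diff1_eq)

lemma even_card_involution:
  assumes "finite A" "\<And>x. x \<in> A \<Longrightarrow> f x \<in> A" "\<And>x. x \<in> A \<Longrightarrow> f (f x) = x"
    "\<And>x. x \<in> A \<Longrightarrow> f x \<noteq> x"
  shows "even (card A)"
  using assms
proof (induction "card A" arbitrary: A rule: less_induct)
  case less
  show ?case
  proof (cases "A = {}")
    case False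
    then obtain a where a: "a \<in> A" by blast
    let ?B = "A - {a, f a}"
    have sub: "{a, f a} \<subseteq> A" "card {a, f a} = 2"
      using a less.prems(2) less.prems(4)[OF a] by auto
    then have cA: "card A = card ?B + 2"
      using less.prems(1) by (metis card_Diff_subset card_mono finite.emptyI finite.insertI
          le_add_diff_inverse2)
    have "f x \<in> ?B" if "x \<in> ?B" for x
      using that a less.prems(2,3) by (metis Diff_iff insertE insertI1 insert_iff singletonD)
    then have "even (card ?B)"
      using less.prems cA by (intro less.hyps) auto
    with cA show ?thesis by simp
  qed simp
qed

text \<open>Iterating this expands a power of a character sum into a single character sum over tuples,
  to which \<open>sum_sum_pair_chi\<close> applies.\<close>

lemma pair_chi_sum_mult:
  fixes f :: "'i::finite \<Rightarrow> (bit ^ 'n) \<times> (bit ^ 'n)" and h :: "'j::finite \<Rightarrow> (bit ^ 'n) \<times> (bit ^ 'n)"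
  shows "(\<Sum>x\<in>UNIV. pair_chi r (f x)) * (\<Sum>y\<in>UNIV. pair_chi r (h y))
    = (\<Sum>t\<in>UNIV. pair_chi r (f (fst t) + h (snd t)))"
  unfolding sum_product sum.cartesian_product UNIV_Times_UNIV
  by (rule sum.cong) (auto simp: pair_chi_add)

section \<open>Graphs in a hyperplane that are Sidon off two points\<close>

text \<open>
  The last condition says that a flat on which \<open>G\<close> sums to zero contains exactly one of \<open>p, q\<close>: off
  these two points the graph of \<open>G\<close> is a Sidon set, and it lies in a hyperplane. The order of the space
  is an integer parameter \<open>Q\<close>, in which the moment computations become polynomial identities.
\<close>

locale punctured_sidon_graph =
  fixes G :: "bit ^ 'n \<Rightarrow> bit ^ 'n" and v p q :: "bit ^ 'n" and Q :: int
  assumes Q_def: "Q = 2 ^ CARD('n)"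
    and v_nonzero: "v \<noteq> 0"
    and dot_v_G: "dot v (G x) = 0"
    and p_neq_q: "p \<noteq> q"
    and flat_through_one: "\<lbrakk>x \<noteq> y; x \<noteq> z; y \<noteq> z; G x + G y + G z = G (x + y + z)\<rbrakk>
      \<Longrightarrow> (p \<in> {x, y, z, x + y + z}) \<noteq> (q \<in> {x, y, z, x + y + z})"
begin

text \<open>The translation that moves the graph point over \<open>p\<close> to the origin. Only signs of the Walsh
  transform depend on it, but they make the third moment count flats through \<open>p\<close>.\<close>

definition shifted :: "bit ^ 'n \<Rightarrow> (bit ^ 'n) \<times> (bit ^ 'n)" where
  "shifted x = (x + p, G x + G p)"

definition walsh :: "(bit ^ 'n) \<times> (bit ^ 'n) \<Rightarrow> int" where
  "walsh r = (\<Sum>x\<in>UNIV. pair_chi r (shifted x))"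

text \<open>Ordered pairs that complete \<open>a\<close> to three distinct points of a flat with value sum zero;
  every such flat is counted six times.\<close>

definition flats_through :: "bit ^ 'n \<Rightarrow> ((bit ^ 'n) \<times> (bit ^ 'n)) set" where
  "flats_through a = {(x, y). x \<noteq> y \<and> x \<noteq> a \<and> y \<noteq> a \<and> G x + G y + G a = G (x + y + a)}"

section \<open>Moments of the Walsh transform\<close>

lemma walsh_sum: "(\<Sum>r\<in>UNIV. walsh r) = Q\<^sup>2"
proof -
  have "{x \<in> UNIV. shifted x = 0} = {p}"
    by (auto simp: shifted_def prod_eq_iff)
  then show ?thesis
    unfolding walsh_def Q_def by (subst sum_sum_pair_chi) auto
qed

lemma walsh_square_sum: "(\<Sum>r\<in>UNIV. (walsh r)\<^sup>2) = Q ^ 3"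
proof -
  have "{t \<in> UNIV. shifted (fst t) + shifted (snd t) = 0} = (\<lambda>x. (x, x)) ` UNIV"
    by (auto simp: shifted_def prod_eq_iff image_iff ac_simps)
  moreover have "card (range (\<lambda>x :: bit ^ 'n. (x, x))) = CARD(bit ^ 'n)"
    by (rule card_image) (auto intro: inj_onI)
  ultimately show ?thesis
    unfolding walsh_def power2_eq_square pair_chi_sum_mult
    by (subst sum_sum_pair_chi) (auto simp: Q_def power2_eq_square power3_eq_cube)
qed

text \<open>The sum counts triples of graph points whose sum is the graph point over \<open>p\<close>. Two points of
  such a triple may agree, which forces the third to be over \<open>p\<close> and accounts for \<open>3Q - 2\<close> triples.\<close>

lemma walsh_cube_sum:
  "(\<Sum>r\<in>UNIV. (walsh r) ^ 3) = Q\<^sup>2 * (3 * Q - 2 + int (card (flats_through p)))"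
proof -
  let ?Z = "{t \<in> UNIV. shifted (fst (fst t)) + shifted (snd (fst t)) + shifted (snd t) = 0}"
  \<comment> \<open>The degenerate pairs: equal points, and the two positions of \<open>p\<close>.\<close>
  let ?A = "(\<lambda>x :: bit ^ 'n. (x, x)) ` UNIV" and ?B = "(\<lambda>x. (x, p)) ` (UNIV - {p})"
    and ?C = "(\<lambda>x. (p, x)) ` (UNIV - {p})"
  have card_A: "int (card ?A) = Q"
    by (subst card_image) (auto simp: inj_on_def Q_def)
  have card_Diff: "int (card (UNIV - {p})) = Q - 1"
    by (subst card_Diff_subset) (auto simp: Q_def of_nat_diff)
  have card_B: "int (card ?B) = Q - 1"
    using card_Diff by (subst card_image) (auto simp: inj_on_def)
  have card_C: "int (card ?C) = Q - 1"
    using card_Diff by (subst card_image) (auto simp: inj_on_def)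
  have "?Z = (\<lambda>(x, y). ((x, y), x + y + p)) ` {(x, y). G x + G y + G p = G (x + y + p)}"
    (is "_ = ?f ` ?Y")
  proof (intro set_eqI iffI)
    fix t assume "t \<in> ?Z"
    then obtain x y z where t: "t = ((x, y), z)"
      and 1: "(x + p) + (y + p) + (z + p) = 0"
      and 2: "(G x + G p) + (G y + G p) + (G z + G p) = 0"
      by (auto simp: shifted_def prod_eq_iff)
    have "z = x + y + p" using 1
      by (simp add: ac_simps bit_vec_swap)
    moreover have "G x + G y + G p = G z" using 2
      by (simp add: ac_simps bit_vec_swap)
    ultimately show "t \<in> ?f ` ?Y" using t by auto
  next
    fix t assume "t \<in> ?f ` ?Y"
    then obtain x y where t: "t = ((x, y), x + y + p)" and 1: "G (x + y + p) = G x + G y + G p"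
      by auto
    show "t \<in> ?Z"
      unfolding mem_Collect_eq t shifted_def fst_conv snd_conv 1
      by (simp add: prod_eq_iff ac_simps)
  qed
  then have "card ?Z = card ?Y"
    by (simp add: card_image inj_on_def split_def)
  also have "?Y = ?A \<union> (?B \<union> (?C \<union> flats_through p))"
    by (auto simp: flats_through_def ac_simps)
  also have "card \<dots> = card ?A + (card ?B + (card ?C + card (flats_through p)))"
    by (subst card_Un_disjoint; (subst card_Un_disjoint)?; (subst card_Un_disjoint)?)
      (auto simp: flats_through_def)
  finally have "int (card ?Z) = 3 * Q - 2 + int (card (flats_through p))"
    using card_A card_B card_C by simp
  then show ?thesis
    unfolding walsh_def Q_def power3_eq_cube pair_chi_sum_mult
    by (subst sum_sum_pair_chi) (auto)
qed

text \<open>The sum counts quadruples of graph points with sum zero. Those with repeated points number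
  \<open>3Q\<^sup>2 - 2Q\<close>; any other is a flat with value sum zero, so it has \<open>p\<close> or \<open>q\<close> in one of four positions.\<close>

lemma walsh_fourth_sum_le:
  "(\<Sum>r\<in>UNIV. (walsh r) ^ 4)
    \<le> Q\<^sup>2 * (3 * Q\<^sup>2 - 2 * Q + 4 * int (card (flats_through p)) + 4 * int (card (flats_through q)))"
proof -
  let ?Z = "{t \<in> UNIV. (shifted (fst (fst t)) + shifted (snd (fst t)))
     + (shifted (fst (snd t)) + shifted (snd (snd t))) = 0}"
  let ?T = "{(x, y, z). x \<noteq> y \<and> x \<noteq> z \<and> y \<noteq> z \<and> G x + G y + G z = G (x + y + z)}"
  \<comment> \<open>The triples with a repetition, by its position; \<open>?B\<close> and \<open>?C\<close> omit the constant triples.\<close>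
  let ?A = "(\<lambda>(x :: bit ^ 'n, y :: bit ^ 'n). (x, x, y)) ` UNIV"
    and ?B = "(\<lambda>(x :: bit ^ 'n, y). (x, y, x)) ` (UNIV - range (\<lambda>x. (x, x)))"
    and ?C = "(\<lambda>(x :: bit ^ 'n, y). (y, x, x)) ` (UNIV - range (\<lambda>x. (x, x)))"
  have "?Z = (\<lambda>(x, y, z). ((x, y), (z, x + y + z))) ` {(x, y, z). G x + G y + G z = G (x + y + z)}"
    (is "_ = ?f ` ?Y")
  proof (intro set_eqI iffI)
    fix t assume "t \<in> ?Z"
    then obtain x y z w where t: "t = ((x, y), (z, w))"
      and 1: "(x + p) + (y + p) + ((z + p) + (w + p)) = 0"
      and 2: "(G x + G p) + (G y + G p) + ((G z + G p) + (G w + G p)) = 0"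
      by (auto simp: shifted_def prod_eq_iff)
    have "w = x + y + z" using 1
      by (simp add: ac_simps bit_vec_swap)
    moreover have "G x + G y + G z = G w" using 2
      by (simp add: ac_simps bit_vec_swap)
    ultimately show "t \<in> ?f ` ?Y" using t by (intro image_eqI[of _ _ "(x, y, z)"]) auto
  next
    fix t assume "t \<in> ?f ` ?Y"
    then obtain x y z where t: "t = ((x, y), (z, x + y + z))"
      and 1: "G (x + y + z) = G x + G y + G z"
      by auto
    show "t \<in> ?Z"
      unfolding mem_Collect_eq t shifted_def fst_conv snd_conv 1
      by (simp add: prod_eq_iff ac_simps)
  qed
  then have "card ?Z = card ?Y"
    by (simp add: card_image inj_on_def split_def)
  also have "?Y \<subseteq> ?A \<union> (?B \<union> (?C \<union> ?T))"
    by (auto simp: image_iff)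
  then have "card ?Y \<le> card (?A \<union> (?B \<union> (?C \<union> ?T)))"
    by (intro card_mono) auto
  also have "\<dots> \<le> card ?A + (card ?B + (card ?C + card ?T))"
    by (meson add_left_mono card_Un_le order_trans)
  finally have 1: "card ?Z \<le> card ?A + (card ?B + (card ?C + card ?T))" .
  have "card (UNIV - range (\<lambda>x :: bit ^ 'n. (x, x))) = CARD((bit ^ 'n) \<times> (bit ^ 'n)) - CARD(bit ^ 'n)"
    by (subst card_Diff_subset) (auto simp: card_image inj_on_def)
  then have 2: "card (UNIV - range (\<lambda>x :: bit ^ 'n. (x, x))) = (2 ^ CARD('n))\<^sup>2 - 2 ^ CARD('n)"
    by (simp add: power2_eq_square)
  have A: "card ?A = (2 ^ CARD('n))\<^sup>2"
    by (subst card_image) (auto simp: inj_on_def power2_eq_square)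
  have B: "card ?B = (2 ^ CARD('n))\<^sup>2 - 2 ^ CARD('n)"
    by (subst card_image) (auto simp: inj_on_def 2)
  have C: "card ?C = (2 ^ CARD('n))\<^sup>2 - 2 ^ CARD('n)"
    by (subst card_image) (auto simp: inj_on_def 2)
  \<comment> \<open>\<open>?U a\<close> collects the triples whose flat has \<open>a\<close> as first, second, third or fourth point.\<close>
  let ?U = "\<lambda>a. (\<lambda>(x, y). (a, x, y)) ` flats_through a \<union> ((\<lambda>(x, y). (x, a, y)) ` flats_through a
    \<union> ((\<lambda>(x, y). (x, y, a)) ` flats_through a \<union> (\<lambda>(x, y). (x, y, x + y + a)) ` flats_through a))"
  have U: "card (?U a) \<le> 4 * card (flats_through a)" for a
  proof -
    have "card (f ` flats_through a) \<le> card (flats_through a)" for f :: "_ \<Rightarrow> (bit ^ 'n) \<times> (bit ^ 'n) \<times> (bit ^ 'n)"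
      by (rule card_image_le) simp
    note this[of "\<lambda>(x, y). (a, x, y)"] this[of "\<lambda>(x, y). (x, a, y)"] this[of "\<lambda>(x, y). (x, y, a)"]
      this[of "\<lambda>(x, y). (x, y, x + y + a)"]
    moreover have "card (?U a) \<le> card ((\<lambda>(x, y). (a, x, y)) ` flats_through a) + (card ((\<lambda>(x, y). (x, a, y)) ` flats_through a)
    + (card ((\<lambda>(x, y). (x, y, a)) ` flats_through a) + card ((\<lambda>(x, y). (x, y, x + y + a)) ` flats_through a)))"
      by (meson add_left_mono card_Un_le order_trans)
    ultimately show ?thesis by linarith
  qed
  have through: "(x, y, z) \<in> ?U a"
    if xyz: "(x, y, z) \<in> ?T" and a: "a \<in> {x, y, z, x + y + z}" for x y z a
  proof -
    consider "x = a" | "y = a" | "z = a" | "a = x + y + z" using a by auto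
    then show ?thesis
    proof cases
      case 1
      then have "(y, z) \<in> flats_through a"
        using xyz by (auto simp: flats_through_def ac_simps)
      with 1 show ?thesis by force
    next
      case 2
      then have "(x, z) \<in> flats_through a"
        using xyz by (auto simp: flats_through_def ac_simps)
      with 2 show ?thesis by force
    next
      case 3
      then have "(x, y) \<in> flats_through a"
        using xyz by (auto simp: flats_through_def ac_simps)
      with 3 show ?thesis by force
    next
      case 4
      then have z: "z = x + y + a" by (simp add: ac_simps bit_vec_swap)
      have "x \<noteq> a" "y \<noteq> a" using xyz 4 by (auto simp: bit_vec_swap ac_simps)
      moreover have "G x + G y + G a = G z"
        using xyz 4 by (auto simp: bit_vec_swap ac_simps)
      ultimately have "(x, y) \<in> flats_through a"
        using xyz z by (auto simp: flats_through_def)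
      with z show ?thesis by force
    qed
  qed
  have "t \<in> ?U p \<union> ?U q" if tT: "t \<in> ?T" for t
  proof -
    obtain x y z where t: "t = (x, y, z)" by (cases t)
    from tT have "p \<in> {x, y, z, x + y + z} \<or> q \<in> {x, y, z, x + y + z}"
      unfolding t using flat_through_one[of x y z] by blast
    then show ?thesis
      using through[of x y z p] through[of x y z q] tT unfolding t by blast
  qed
  then have "card ?T \<le> card (?U p \<union> ?U q)"
    by (intro card_mono subsetI) simp_all
  also have "\<dots> \<le> card (?U p) + card (?U q)" by (rule card_Un_le)
  finally have "card ?T \<le> 4 * card (flats_through p) + 4 * card (flats_through q)"
    using U[of p] U[of q] by linarith
  with 1 have "card ?Z \<le> (2 ^ CARD('n))\<^sup>2 + 2 * ((2 ^ CARD('n))\<^sup>2 - 2 ^ CARD('n))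
       + 4 * card (flats_through p) + 4 * card (flats_through q)"
    unfolding A B C by linarith
  then have "int (card ?Z) \<le> int ((2 ^ CARD('n))\<^sup>2 + 2 * ((2 ^ CARD('n))\<^sup>2 - 2 ^ CARD('n))
       + 4 * card (flats_through p) + 4 * card (flats_through q))"
    by (rule zle_int[THEN iffD2])
  also have "\<dots> = 3 * Q\<^sup>2 - 2 * Q + 4 * int (card (flats_through p)) + 4 * int (card (flats_through q))"
    by (simp add: Q_def of_nat_diff power2_eq_square)
  finally have "Q\<^sup>2 * int (card ?Z) \<le> Q\<^sup>2 * (3 * Q\<^sup>2 - 2 * Q + 4 * int (card (flats_through p)) + 4 * int (card (flats_through q)))"
    by (rule mult_left_mono) simp
  moreover have "(\<Sum>r\<in>UNIV. (walsh r) ^ 4) = Q\<^sup>2 * int (card ?Z)"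
  proof -
    have *: "x ^ 4 = (x * x) * (x * x)" for x :: int by (simp add: eval_nat_numeral)
    show ?thesis
      unfolding walsh_def * Q_def pair_chi_sum_mult by (subst sum_sum_pair_chi) (auto simp only: finite finite_UNIV)
  qed
  ultimately show ?thesis by simp
qed

section \<open>The possible Walsh values\<close>

lemma Q_pos: "0 < Q"
  by (simp add: Q_def)

lemma walsh_trivial:
  assumes "snd r \<in> {0, v}"
  shows "walsh r = (if fst r = 0 then Q else 0)"
proof -
  have "dot (snd r) (G y) = 0" for y
    using assms dot_v_G by auto
  then have "pair_chi r (shifted x) = chi (dot (x + p) (fst r))" for x
    by (simp add: pair_chi_def shifted_def dot_add_right dot_commute[of "x + p"])
  then have "walsh r = (\<Sum>x\<in>UNIV. chi (dot (x + p) (fst r)))"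
    by (simp add: walsh_def)
  also have "\<dots> = (\<Sum>x\<in>UNIV. chi (dot x (fst r)))"
    by (rule sum_shift)
  finally show ?thesis by (simp add: sum_chi_dot Q_def)
qed

text \<open>A coincidence at \<open>x\<close> and \<open>y\<close> yields the flat through \<open>x, y\<close> with direction \<open>p + q\<close>, which
  contains both of \<open>p, q\<close> or neither.\<close>

lemma derivative_eq_iff:
  "G x + G (x + (p + q)) = G y + G (y + (p + q)) \<longleftrightarrow> y = x \<or> y = x + (p + q)"
proof
  assume eq: "G x + G (x + (p + q)) = G y + G (y + (p + q))"
  show "y = x \<or> y = x + (p + q)"
  proof (rule ccontr)
    assume ne: "\<not> ?thesis"
    let ?z = "x + (p + q)"
    have t: "x + ?z + y = y + (p + q)" by (simp add: ac_simps)
    have "x \<noteq> ?z" using p_neq_q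
      by (metis bit_vec_add_eq_0_iff bit_vec_add_left_self bit_vec_add_self)
    moreover have "G x + G ?z + G y = G (x + ?z + y)"
      unfolding eq t by (simp add: ac_simps)
    ultimately have "(p \<in> {x, ?z, y, y + (p + q)}) \<noteq> (q \<in> {x, ?z, y, y + (p + q)})"
      using flat_through_one[of x ?z y] ne unfolding t by auto
    moreover have "p \<in> {a, a + (p + q)} \<longleftrightarrow> q \<in> {a, a + (p + q)}" for a
      by (auto simp: ac_simps bit_vec_swap)
    ultimately show False by blast
  qed
qed (auto simp: ac_simps)

text \<open>By \<open>derivative_eq_iff\<close> the derivative has \<open>2Q\<close> collisions. The two characters that are trivial on
  its range already use up the corresponding total \<open>2Q\<^sup>2\<close> in Parseval's identity.\<close>

lemma derivative_balanced:
  assumes "w \<notin> {0, v}"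
  shows "(\<Sum>x\<in>UNIV. chi (dot w (G x + G (x + (p + q))))) = 0"
proof -
  let ?A = "\<lambda>w. (\<Sum>x\<in>UNIV. chi (dot w (G x + G (x + (p + q)))))"
  let ?e = "p + q"
  have e: "?e \<noteq> 0" using p_neq_q by simp
  have "{(x, y). G x + G (x + ?e) = G y + G (y + ?e)}
      = range (\<lambda>x. (x, x)) \<union> range (\<lambda>x. (x, x + ?e))"
    unfolding derivative_eq_iff by auto
  also have "card \<dots> = card (range (\<lambda>x :: bit ^ 'n. (x, x))) + card (range (\<lambda>x. (x, x + ?e)))"
    using e by (intro card_Un_disjoint) auto
  also have "int \<dots> = 2 * Q"
    by (simp add: card_image inj_on_def Q_def)
  finally have "(\<Sum>w\<in>UNIV. (?A w)\<^sup>2) = Q * (2 * Q)"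
    by (simp only: sum_square_chi_dot Q_def)
  moreover have "(\<Sum>w\<in>UNIV. (?A w)\<^sup>2) = (\<Sum>w\<in>UNIV - {0, v}. (?A w)\<^sup>2) + (\<Sum>w\<in>{0, v}. (?A w)\<^sup>2)"
    by (rule sum.subset_diff) auto
  moreover have "?A 0 = Q" "?A v = Q"
    by (simp_all add: dot_add_right dot_v_G Q_def)
  then have "(\<Sum>w\<in>{0, v}. (?A w)\<^sup>2) = Q * (2 * Q)"
    using v_nonzero by (simp add: power2_eq_square)
  ultimately have "(\<Sum>w\<in>UNIV - {0, v}. (?A w)\<^sup>2) = 0"
    by linarith
  then have "\<forall>w\<in>UNIV - {0, v}. (?A w)\<^sup>2 = 0"
    by (subst (asm) sum_nonneg_eq_0_iff) auto
  with assms show ?thesis by auto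
qed

text \<open>Let \<open>g\<close> be the sign function summed in \<open>walsh r\<close> and \<open>e = p + q\<close>. As \<open>g\<close> is orthogonal to its
  translate by \<open>e\<close>, the sum of \<open>(1 - g(x)) (1 - g(x + e))\<close> is \<open>Q - 2 walsh r\<close>. It is also four times
  the number of \<open>x\<close> with \<open>g(x) = g(x + e) = -1\<close>, and these \<open>x\<close> come in pairs \<open>x, x + e\<close>.\<close>

lemma four_dvd_walsh:
  assumes "8 dvd Q" and "snd r \<notin> {0, v}"
  shows "4 dvd walsh r"
proof -
  let ?e = "p + q"
  let ?g = "\<lambda>x. pair_chi r (shifted x)"
  let ?N = "{x. ?g x = -1 \<and> ?g (x + ?e) = -1}"
  have g: "?g x = 1 \<or> ?g x = -1" for x
    by (auto simp: pair_chi_def chi_def)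
  have shift: "(\<Sum>x\<in>UNIV. ?g (x + ?e)) = walsh r"
    unfolding walsh_def by (rule sum_shift)
  have "?g x * ?g (x + ?e) = chi (dot (fst r) ?e) * chi (dot (snd r) (G x + G (x + ?e)))" for x
  proof -
    have "shifted x + shifted (x + ?e) = (?e, G x + G (x + ?e))"
      by (simp add: shifted_def ac_simps)
    then show ?thesis unfolding pair_chi_add[symmetric] by (simp add: pair_chi_def)
  qed
  then have orthogonal: "(\<Sum>x\<in>UNIV. ?g x * ?g (x + ?e)) = 0"
    using derivative_balanced[OF assms(2)] by (simp flip: sum_distrib_left)
  have "(\<Sum>x\<in>UNIV. (1 - ?g x) * (1 - ?g (x + ?e)))
      = (\<Sum>x\<in>(UNIV :: (bit ^ 'n) set). 1) - (\<Sum>x\<in>UNIV. ?g x) - (\<Sum>x\<in>UNIV. ?g (x + ?e))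
        + (\<Sum>x\<in>UNIV. ?g x * ?g (x + ?e))"
    unfolding sum_subtractf[symmetric] sum.distrib[symmetric]
    by (rule sum.cong) (auto simp: algebra_simps)
  also have "\<dots> = Q - 2 * walsh r"
    unfolding shift orthogonal by (simp add: walsh_def Q_def)
  finally have "(\<Sum>x\<in>UNIV. (1 - ?g x) * (1 - ?g (x + ?e))) = Q - 2 * walsh r" .
  moreover have "(\<Sum>x\<in>UNIV. (1 - ?g x) * (1 - ?g (x + ?e))) = (\<Sum>x\<in>UNIV. if x \<in> ?N then 4 else 0)"
  proof (rule sum.cong)
    fix x
    show "(1 - ?g x) * (1 - ?g (x + ?e)) = (if x \<in> ?N then 4 else 0)"
      using g[of x] g[of "x + ?e"] by auto
  qed simp
  ultimately have "Q - 2 * walsh r = 4 * int (card ?N)"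
    by (simp add: sum.If_cases)
  moreover obtain a where "Q = 8 * a" using assms(1) by blast
  moreover have "even (card ?N)"
    by (rule even_card_involution[of _ "\<lambda>x. x + ?e"]) (use p_neq_q in \<open>auto simp: ac_simps bit_vec_swap\<close>)
  then obtain b where "card ?N = 2 * b" by blast
  ultimately have "walsh r = 4 * (a - int b)" by simp
  then show ?thesis by simp
qed

text \<open>The polynomial \<open>P\<close> has its roots at two pairs of neighbouring multiples of four, so it is
  nonnegative at the nontrivial Walsh values. By the moments, the sum of \<open>P\<close> over all
  characters is at most the share of the trivial ones plus a positive multiple of the excess of flats
  through \<open>q\<close> over flats through \<open>p\<close>, which is not positive.\<close>

lemma walsh_values:
  assumes s: "Q = s\<^sup>2" "4 dvd s" and le: "card (flats_through q) \<le> card (flats_through p)"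
    and r: "snd r \<notin> {0, v}"
  shows "walsh r \<in> {s, -s, 4 + s, 4 - s}"
proof -
  define P where "P M = (M\<^sup>2 - s\<^sup>2) * ((M - 4)\<^sup>2 - s\<^sup>2)" for M :: int
  let ?I = "(UNIV :: (bit ^ 'n) set) \<times> {0, v}"
  have "8 dvd Q"
    using s by (auto simp: power2_eq_square elim!: dvdE)
  have P_nonneg: "0 \<le> P (walsh r)" if "r \<notin> ?I" for r
  proof -
    obtain m where m: "walsh r = 4 * m"
      using four_dvd_walsh[OF \<open>8 dvd Q\<close>, of r] \<open>r \<notin> ?I\<close> by (auto simp: mem_Times_iff)
    obtain k where k: "s = 4 * k" using s by blast
    have "P (walsh r) = 256 * (((m - k) * (m - k - 1)) * ((m + k) * (m + k - 1)))"
      unfolding P_def m k by algebra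
    then show ?thesis using prod_consecutive_nonneg by simp
  qed
  have P_expand: "P M = M ^ 4 - 8 * M ^ 3 + (16 - 2 * Q) * M\<^sup>2 + 8 * Q * M + (Q\<^sup>2 - 16 * Q)" for M
    unfolding P_def s by algebra
  have "(\<Sum>r\<in>UNIV. P (walsh r)) = (\<Sum>r\<in>UNIV. walsh r ^ 4) - 8 * (\<Sum>r\<in>UNIV. walsh r ^ 3)
      + (16 - 2 * Q) * (\<Sum>r\<in>UNIV. (walsh r)\<^sup>2) + 8 * Q * (\<Sum>r\<in>UNIV. walsh r)
      + (Q\<^sup>2 - 16 * Q) * int (CARD((bit ^ 'n) \<times> (bit ^ 'n)))"
    by (simp add: P_expand sum.distrib sum_subtractf sum_distrib_left)
  also have "int (CARD((bit ^ 'n) \<times> (bit ^ 'n))) = Q\<^sup>2"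
    by (simp add: Q_def power2_eq_square)
  finally have "(\<Sum>r\<in>UNIV. P (walsh r)) \<le>
      Q\<^sup>2 * (3 * Q\<^sup>2 - 2 * Q + 4 * int (card (flats_through p)) + 4 * int (card (flats_through q)))
      - 8 * (Q\<^sup>2 * (3 * Q - 2 + int (card (flats_through p))))
      + (16 - 2 * Q) * Q ^ 3 + 8 * Q * Q\<^sup>2 + (Q\<^sup>2 - 16 * Q) * Q\<^sup>2"
    using walsh_fourth_sum_le unfolding walsh_sum walsh_square_sum walsh_cube_sum by linarith
  also have "\<dots> = 2 * Q\<^sup>2 * (Q - 1) * (Q - 8)
      + 4 * Q\<^sup>2 * (int (card (flats_through q)) - int (card (flats_through p)))"
    by algebra
  also have "\<dots> \<le> 2 * Q\<^sup>2 * (Q - 1) * (Q - 8)"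
    using le by (simp add: mult_nonneg_nonpos)
  finally have upper: "(\<Sum>r\<in>UNIV. P (walsh r)) \<le> 2 * Q\<^sup>2 * (Q - 1) * (Q - 8)" .
  \<comment> \<open>The trivial characters contribute exactly this bound, which leaves nothing for the others.\<close>
  have "(\<Sum>r\<in>?I. P (walsh r)) = (\<Sum>r\<in>?I. P (if fst r = 0 then Q else 0))"
    by (rule sum.cong) (auto simp: walsh_trivial)
  also have "(\<Sum>r\<in>(UNIV :: (bit ^ 'n) set) \<times> {0, v}. P (if fst r = 0 then Q else 0))
      = (\<Sum>u\<in>(UNIV :: (bit ^ 'n) set). \<Sum>w\<in>{0, v}. P (if u = 0 then Q else 0))"
    unfolding sum.cartesian_product split_def ..
  also have "\<dots> = 2 * (\<Sum>u\<in>(UNIV :: (bit ^ 'n) set). P (if u = 0 then Q else 0))"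
    using v_nonzero by (simp add: sum_distrib_left)
  also have "(\<Sum>u\<in>(UNIV :: (bit ^ 'n) set). P (if u = 0 then Q else 0))
      = P Q + (\<Sum>u\<in>(UNIV :: (bit ^ 'n) set) - {0}. P 0)"
    by (subst sum.remove[of _ 0]) auto
  also have "(\<Sum>u\<in>(UNIV :: (bit ^ 'n) set) - {0}. P 0) = (Q - 1) * P 0"
    by (simp add: card_Diff_subset Q_def of_nat_diff)
  also have "2 * (P Q + (Q - 1) * P 0) = 2 * Q\<^sup>2 * (Q - 1) * (Q - 8)"
    unfolding P_expand by (simp add: algebra_simps eval_nat_numeral)
  finally have "(\<Sum>r\<in>?I. P (walsh r)) = 2 * Q\<^sup>2 * (Q - 1) * (Q - 8)" .
  moreover have "(\<Sum>r\<in>UNIV. P (walsh r)) = (\<Sum>r\<in>UNIV - ?I. P (walsh r)) + (\<Sum>r\<in>?I. P (walsh r))"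
    by (rule sum.subset_diff) auto
  ultimately have "(\<Sum>r\<in>UNIV - ?I. P (walsh r)) \<le> 0" using upper by linarith
  moreover have "0 \<le> (\<Sum>r\<in>UNIV - ?I. P (walsh r))"
    using P_nonneg by (intro sum_nonneg) auto
  ultimately have "(\<Sum>r\<in>UNIV - ?I. P (walsh r)) = 0" by linarith
  then have "\<forall>r\<in>UNIV - ?I. P (walsh r) = 0"
    by (subst (asm) sum_nonneg_eq_0_iff) (use P_nonneg in auto)
  then have "P (walsh r) = 0" using r by (simp add: mem_Times_iff)
  then have "(walsh r)\<^sup>2 = s\<^sup>2 \<or> (walsh r - 4)\<^sup>2 = s\<^sup>2"
    by (simp add: P_def)
  then show ?thesis by (auto simp: power2_eq_iff)
qed

section \<open>Divisibility excludes even dimensions from six on\<close>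

text \<open>Write the Walsh values at \<open>u = 0\<close> as \<open>\<epsilon> s + 4 \<delta>\<close> with a sign \<open>\<epsilon>\<close> and \<open>\<delta> \<in> {0, 1}\<close>. Let \<open>w\<close> run
  over a complement \<open>W\<close> of the line \<open>{0, v}\<close>, without zero, and let \<open>E\<close>, \<open>D\<close> and \<open>X\<close> be the sums of \<open>\<epsilon>\<close>,
  \<open>\<delta>\<close> and \<open>\<epsilon> \<delta>\<close>. The sum of the values is known modulo \<open>Q / 2\<close>; as \<open>E\<close> has an odd number of terms, \<open>D\<close>
  is an odd multiple of \<open>s / 4\<close>. The sum of the squares is divisible by \<open>Q\<close>, which makes the same multiple
  even.\<close>

lemma not_8_dvd_sqrt:
  assumes s: "Q = s\<^sup>2" and le: "card (flats_through q) \<le> card (flats_through p)"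
  shows "\<not> 8 dvd s"
proof
  assume "8 dvd s"
  then have "4 dvd s" by (rule dvd_trans[rotated]) simp
  obtain \<rho> where \<rho>: "s = 8 * \<rho>" using \<open>8 dvd s\<close> by blast
  have Q\<rho>: "Q = 64 * \<rho>\<^sup>2" unfolding s \<rho> by algebra
  then have \<rho>_nonzero: "\<rho> \<noteq> 0" using Q_pos by auto
  obtain y where "dot y v = 1"
    using ex_dot_eq_1[OF v_nonzero] by blast
  then have y: "dot v y = 1" by (simp add: dot_commute)
  define W where "W = {w. dot w y = 0}"
  have W0: "0 \<in> W" and vW: "v \<notin> W" using y by (auto simp: W_def)
  have half: "(\<Sum>w\<in>UNIV. f w) = 2 * (\<Sum>w\<in>W. f w)" if f: "\<And>w. f (w + v) = f w" for f :: "_ \<Rightarrow> int"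
  proof -
    have "(\<Sum>w\<in>UNIV - W. f w) = (\<Sum>w\<in>W. f w)"
      by (rule sum.reindex_bij_witness[of _ "\<lambda>w. w + v" "\<lambda>w. w + v"])
        (auto simp: W_def dot_add_left y f ac_simps)
    moreover have "(\<Sum>w\<in>UNIV. f w) = (\<Sum>w\<in>UNIV - W. f w) + (\<Sum>w\<in>W. f w)"
      by (rule sum.subset_diff) auto
    ultimately show ?thesis by simp
  qed
  define N where "N w = (\<Sum>x\<in>UNIV. chi (dot w (G x + G p)))" for w
  have N_walsh: "N w = walsh (0, w)" for w
    by (simp add: N_def walsh_def pair_chi_def shifted_def)
  have N_add: "N (w + v) = N w" for w
    by (simp add: N_def dot_add_left dot_add_right dot_v_G)
  have N_0: "N 0 = Q" by (simp add: N_def Q_def)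
  define K1 where "K1 = int (card {x \<in> UNIV. G x + G p = 0})"
  define K2 where "K2 = card {(x, y). G x = G y}"
  have cardW: "2 * int (card W) = Q"
    using half[of "\<lambda>w. 1"] by (simp add: Q_def)
  have N_sum: "2 * (\<Sum>w\<in>W. N w) = Q * K1"
    using half[of N] N_add unfolding N_def K1_def Q_def by (simp only: sum_sum_chi_dot finite)
  have "{(x, y). G x + G p = G y + G p} = {(x, y). G x = G y}" by auto
  then have N_square_sum: "2 * (\<Sum>w\<in>W. (N w)\<^sup>2) = Q * int K2"
    using half[of "\<lambda>w. (N w)\<^sup>2"] N_add unfolding N_def K2_def Q_def
    by (simp only: sum_square_chi_dot)
  \<comment> \<open>Off the diagonal the collisions of \<open>G\<close> come in pairs \<open>(x, y), (y, x)\<close>.\<close>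
  have "even K2"
  proof -
    let ?D = "{(x, y). G x = G y \<and> x \<noteq> y}"
    have "{(x, y). G x = G y} = range (\<lambda>x. (x, x)) \<union> ?D" by auto
    moreover have "card (range (\<lambda>x :: bit ^ 'n. (x, x)) \<union> ?D) = card (range (\<lambda>x :: bit ^ 'n. (x, x))) + card ?D"
      by (rule card_Un_disjoint) auto
    moreover have "even (card ?D)"
      by (rule even_card_involution[of _ prod.swap]) auto
    moreover have "even (card (range (\<lambda>x :: bit ^ 'n. (x, x))))"
      by (simp add: card_image inj_on_def)
    ultimately show ?thesis unfolding K2_def by simp
  qed
  then obtain k where k: "K2 = 2 * k" by blast
  define \<epsilon> :: "_ \<Rightarrow> int" where "\<epsilon> w = (if N w = s \<or> N w = 4 + s then 1 else -1)" for w
  define \<delta> :: "_ \<Rightarrow> int" where "\<delta> w = (if N w = s \<or> N w = -s then 0 else 1)" for w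
  have N_eq: "N w = \<epsilon> w * s + 4 * \<delta> w" if "w \<in> W - {0}" for w
  proof -
    have "w \<notin> {0, v}" using that vW by auto
    then have "N w \<in> {s, -s, 4 + s, 4 - s}"
      unfolding N_walsh using s \<open>4 dvd s\<close> le by (intro walsh_values) auto
    then show ?thesis
      using \<rho>_nonzero by (auto simp: \<epsilon>_def \<delta>_def \<rho>)
  qed
  have N_square: "(N w)\<^sup>2 = Q + 8 * s * (\<epsilon> w * \<delta> w) + 16 * \<delta> w" if "w \<in> W - {0}" for w
  proof -
    have "\<epsilon> w * \<epsilon> w = 1" "\<delta> w * \<delta> w = \<delta> w" by (auto simp: \<epsilon>_def \<delta>_def)
    then show ?thesis unfolding N_eq[OF that] s by algebra
  qed
  define E D X where "E = (\<Sum>w\<in>W - {0}. \<epsilon> w)" and "D = (\<Sum>w\<in>W - {0}. \<delta> w)"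
    and "X = (\<Sum>w\<in>W - {0}. \<epsilon> w * \<delta> w)"
  have fin: "finite W" by simp
  have "(\<Sum>w\<in>W. N w) = Q + (\<Sum>w\<in>W - {0}. N w)"
    using sum.remove[OF fin W0, of N] N_0 by simp
  also have "(\<Sum>w\<in>W - {0}. N w) = E * s + 4 * D"
    by (simp add: N_eq sum.distrib E_def D_def sum_distrib_left sum_distrib_right)
  finally have "2 * (Q + (E * s + 4 * D)) = Q * K1" using N_sum by simp
  \<comment> \<open>Twice \<open>\<rho> = s / 8\<close> is \<open>s / 4\<close>, and the cofactor has the parity of \<open>E\<close>.\<close>
  then have D: "D = 2 * \<rho> * (4 * \<rho> * K1 - 8 * \<rho> - E)"
    unfolding Q\<rho> \<rho> by (simp add: power2_eq_square algebra_simps)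
  have card: "int (card (W - {0})) = 32 * \<rho>\<^sup>2 - 1"
    using cardW W0 card_Suc_Diff1[OF fin W0] unfolding Q\<rho> by linarith
  have "(\<Sum>w\<in>W. (N w)\<^sup>2) = Q\<^sup>2 + (\<Sum>w\<in>W - {0}. (N w)\<^sup>2)"
    using sum.remove[OF fin W0, of "\<lambda>w. (N w)\<^sup>2"] N_0 by simp
  also have "(\<Sum>w\<in>W - {0}. (N w)\<^sup>2) = (32 * \<rho>\<^sup>2 - 1) * Q + 8 * s * X + 16 * D"
    by (simp add: N_square sum.distrib X_def D_def flip: sum_distrib_left card)
  finally have "2 * (Q\<^sup>2 + ((32 * \<rho>\<^sup>2 - 1) * Q + 8 * s * X + 16 * D)) = Q * (2 * int k)"
    using N_square_sum k by simp
  then have "\<rho> * (32 * (2 * X + (4 * \<rho> * K1 - 8 * \<rho> - E)))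
      = \<rho> * (32 * (2 * \<rho> * (int k - 64 * \<rho>\<^sup>2 - (32 * \<rho>\<^sup>2 - 1))))"
    unfolding Q\<rho> \<rho> D by algebra
  then have "2 * X + (4 * \<rho> * K1 - 8 * \<rho> - E) = 2 * \<rho> * (int k - 64 * \<rho>\<^sup>2 - (32 * \<rho>\<^sup>2 - 1))"
    using \<rho>_nonzero by simp
  then have "E = 2 * (X + 2 * \<rho> * K1 - 4 * \<rho> - \<rho> * (int k - 64 * \<rho>\<^sup>2 - (32 * \<rho>\<^sup>2 - 1)))"
    by (simp add: algebra_simps)
  then have "even E" by simp
  moreover have "odd E"
  proof -
    have "{w \<in> W - {0}. odd (\<epsilon> w)} = W - {0}" by (auto simp: \<epsilon>_def)
    then have "even E \<longleftrightarrow> even (int (card (W - {0})))"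
      unfolding E_def by (subst even_sum_iff) simp_all
    then show ?thesis unfolding card by simp
  qed
  ultimately show False by simp
qed

end

lemma punctured_sidon_graph_swap:
  assumes "punctured_sidon_graph G v p q Q"
  shows "punctured_sidon_graph G v q p Q"
  using assms unfolding punctured_sidon_graph_def by (metis (no_types, lifting))

text \<open>The two points play symmetric roles, so the one on more flats may be taken as \<open>p\<close>.\<close>

lemma no_punctured_sidon_graph:
  fixes G :: "bit ^ 'n \<Rightarrow> bit ^ 'n"
  assumes "punctured_sidon_graph G v p q (2 ^ CARD('n))" and "even CARD('n)" and "CARD('n) \<ge> 6"
  shows False
proof -
  define s :: int where "s = 2 ^ (CARD('n) div 2)"
  have "(2 :: int) ^ CARD('n) = s\<^sup>2"
    using assms(2) by (auto simp: s_def simp flip: power_mult)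
  moreover have "8 dvd s"
    unfolding s_def using le_imp_power_dvd[of 3 "CARD('n) div 2" "2 :: int"] assms(3) by simp
  moreover note punctured_sidon_graph.not_8_dvd_sqrt[OF assms(1)]
    punctured_sidon_graph.not_8_dvd_sqrt[OF punctured_sidon_graph_swap[OF assms(1)]]
  ultimately show False
    using nat_le_linear by blast
qed

section \<open>Dimension four\<close>

lemma card_sym_diff:
  assumes "finite A" "finite B"
  shows "card (sym_diff A B) + 2 * card (A \<inter> B) = card A + card B"
proof -
  have "card (sym_diff A B) = card (A - B) + card (B - A)"
    using assms by (intro card_Un_disjoint) auto
  moreover have "card A = card (A - B) + card (A \<inter> B)" "card B = card (B - A) + card (A \<inter> B)"
    using assms card_Int_Diff[of A B] card_Int_Diff[of B A] by (simp_all add: Int_commute)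
  ultimately show ?thesis by simp
qed

lemma sum_sym_diff:
  fixes h :: "'i \<Rightarrow> bit ^ 'n"
  assumes "finite A" "finite B"
  shows "sum h (sym_diff A B) = sum h A + sum h B"
proof -
  have "sum h (sym_diff A B) = sum h (A - B) + sum h (B - A)"
    using assms by (intro sum.union_disjoint) auto
  moreover have "sum h A = sum h (A \<inter> B) + sum h (A - B)" "sum h B = sum h (A \<inter> B) + sum h (B - A)"
    using assms sum.Int_Diff[of A h B] sum.Int_Diff[of B h A] by (simp_all add: Int_commute)
  ultimately show ?thesis by (simp add: ac_simps)
qed

lemma card_4_elements:
  assumes "card Z = 4"
  shows "\<exists>x y z t. Z = {x, y, z, t} \<and> distinct [x, y, z, t]"
proof -
  have "finite Z" using assms card.infinite by fastforce
  then obtain xs where "set xs = Z" "distinct xs" using finite_distinct_list by blast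
  moreover from this have "length xs = 4" using assms distinct_card by metis
  then obtain x y z t where "xs = [x, y, z, t]"
    by (auto simp: eval_nat_numeral length_Suc_conv)
  ultimately show ?thesis by force
qed

context punctured_sidon_graph
begin

definition zero_sum :: "(bit ^ 'n) set \<Rightarrow> bool" where
  "zero_sum Z \<longleftrightarrow> Z \<inter> {p, q} = {} \<and> (\<Sum>x\<in>Z. x) = 0 \<and> (\<Sum>x\<in>Z. G x) = 0"

lemma zero_sum_sym_diff: "zero_sum Y \<Longrightarrow> zero_sum Z \<Longrightarrow> zero_sum (sym_diff Y Z)"
  by (auto simp: zero_sum_def sum_sym_diff)

lemma zero_sum_of_equal_sums:
  assumes "Y \<inter> {p, q} = {}" "Z \<inter> {p, q} = {}" "(\<Sum>x\<in>Y. x) = (\<Sum>x\<in>Z. x)" "(\<Sum>x\<in>Y. G x) = (\<Sum>x\<in>Z. G x)"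
  shows "zero_sum (sym_diff Y Z)"
  using assms by (auto simp: zero_sum_def sum_sym_diff)

text \<open>Two equal points would be needed for a zero sum of size two, and one of size four would be a
  flat that avoids both \<open>p\<close> and \<open>q\<close>.\<close>

lemma zero_sum_even_card:
  assumes rel: "zero_sum Z" and "even (card Z)" "Z \<noteq> {}"
  shows "6 \<le> card Z"
proof (rule ccontr)
  assume "\<not> ?thesis"
  moreover have "0 < card Z" using assms(3) by (simp add: card_gt_0_iff)
  ultimately have "card Z = 2 \<or> card Z = 4" using assms(2) by presburger
  then consider "card Z = 2" | "card Z = 4" by blast
  then show False
  proof cases
    case 1
    then obtain x y where "Z = {x, y}" "x \<noteq> y" by (auto simp: card_2_iff)
    then show False using rel by (auto simp: zero_sum_def)
  next
    case 2
    then obtain x y z t where Z: "Z = {x, y, z, t}" "distinct [x, y, z, t]"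
      using card_4_elements by blast
    then have "x + (y + (z + t)) = 0" "G x + (G y + (G z + G t)) = 0"
      and out: "p \<notin> Z" "q \<notin> Z"
      using rel by (auto simp: zero_sum_def)
    then have "t = x + y + z" "G x + G y + G z = G t"
      by (simp_all add: ac_simps bit_vec_swap)
    then show False
      using flat_through_one[of x y z] Z out by auto
  qed
qed

text \<open>The point sums in the pigeonhole arguments below lie in a hyperplane, which halves the number
  of pigeonholes.\<close>

lemma dot_v_sum_G: "dot v (\<Sum>x\<in>Z. G x) = 0"
proof (induction Z rule: infinite_finite_induct)
  case (insert x Z)
  then show ?case by (simp add: dot_add_right dot_v_G)
qed simp_all

text \<open>There are \<open>364\<close> triples among the fourteen points off \<open>p, q\<close> and \<open>128\<close> possible sums, which
  gives a zero-sum set \<open>C\<close> of six points. Subsets of \<open>C\<close> up to complement (those without a fixed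
  \<open>a \<in> C\<close>), joined with at most one of the other eight points, number \<open>32 \<cdot> 9 = 288\<close>, against \<open>256\<close> pairs
  of a sum and a parity. A coincidence is an even zero-sum set, and it or its symmetric difference with
  \<open>C\<close> has fewer than six points.\<close>

lemma dimension_neq_4: "CARD('n) \<noteq> 4"
proof
  assume n: "CARD('n) = 4"
  let ?S = "UNIV - {p, q}"
  let ?H = "{z. dot v z = 0}"
  let ?sum = "\<lambda>Z. (\<Sum>x\<in>Z. x, \<Sum>x\<in>Z. G x)"
  have card_S: "card ?S = 14"
    using p_neq_q by (subst card_Diff_subset) (auto simp: n)
  have card_H: "card ?H = 8"
    using card_hyperplane[OF v_nonzero] by (simp add: n)
  have "\<exists>C. zero_sum C \<and> card C = 6"
  proof -
    let ?T = "{Z. Z \<subseteq> ?S \<and> card Z = 3}"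
    have "card (?sum ` ?T) \<le> card ((UNIV :: (bit ^ 'n) set) \<times> ?H)"
      by (intro card_mono) (auto simp: dot_v_sum_G)
    also have "\<dots> = 128" by (simp add: card_cartesian_product card_H n)
    also have "128 < (14 choose 3 :: nat)" by (simp add: eval_nat_numeral)
    also have "\<dots> = card ?T" by (subst n_subsets) (simp_all add: card_S)
    finally have "\<not> inj_on ?sum ?T" by (rule pigeonhole)
    then obtain Y Z where YZ: "Y \<in> ?T" "Z \<in> ?T" "Y \<noteq> Z" "?sum Y = ?sum Z"
      by (auto simp: inj_on_def)
    let ?C = "sym_diff Y Z"
    have rel: "zero_sum ?C" using YZ by (intro zero_sum_of_equal_sums) auto
    have "card ?C + 2 * card (Y \<inter> Z) = 6"
      using YZ card_sym_diff[of Y Z] by simp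
    moreover have "6 \<le> card ?C"
    proof (rule zero_sum_even_card[OF rel])
      show "even (card ?C)"
        using \<open>card ?C + 2 * card (Y \<inter> Z) = 6\<close> by presburger
      show "?C \<noteq> {}" using YZ by blast
    qed
    ultimately show ?thesis using rel by auto
  qed
  then obtain C where C: "zero_sum C" "card C = 6" by blast
  then obtain a where a: "a \<in> C" by fastforce
  have C_S: "C \<subseteq> ?S" using C by (auto simp: zero_sum_def)
  let ?Y = "insert {} ((\<lambda>t. {t}) ` (?S - C))"
  let ?A = "Pow (C - {a}) \<times> ?Y"
  let ?f = "\<lambda>(X, Y). (?sum (X \<union> Y), even (card (X \<union> Y)))"
  have "card (?S - C) = 8"
    using C_S C card_S by (subst card_Diff_subset) auto
  then have "card ((\<lambda>t. {t}) ` (?S - C)) = 8"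
    by (subst card_image) auto
  moreover have "{} \<notin> (\<lambda>t. {t}) ` (?S - C)" by auto
  ultimately have "card ?Y = 9" by simp
  moreover have "card (Pow (C - {a})) = 32"
    using C a by (simp add: card_Pow)
  ultimately have "card ?A = 288"
    by (simp only: card_cartesian_product)
  moreover have "card (?f ` ?A) \<le> card (((UNIV :: (bit ^ 'n) set) \<times> ?H) \<times> (UNIV :: bool set))"
    by (intro card_mono) (auto simp: dot_v_sum_G)
  then have "card (?f ` ?A) \<le> 256"
    by (simp add: card_cartesian_product card_H n)
  ultimately have "\<not> inj_on ?f ?A" by (intro pigeonhole) simp
  then obtain s t where "s \<in> ?A" "t \<in> ?A" "s \<noteq> t" "?f s = ?f t"
    unfolding inj_on_def by blast
  moreover obtain X Y X' Y' where "s = (X, Y)" "t = (X', Y')" by (cases s; cases t)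
  ultimately have XY: "(X, Y) \<in> ?A" "(X', Y') \<in> ?A" "(X, Y) \<noteq> (X', Y')"
    and eq: "?sum (X \<union> Y) = ?sum (X' \<union> Y')" "even (card (X \<union> Y)) \<longleftrightarrow> even (card (X' \<union> Y'))"
    by simp_all
  let ?Z = "sym_diff (X \<union> Y) (X' \<union> Y')"
  let ?P = "sym_diff X X'" and ?R = "sym_diff Y Y'"
  have XC: "X \<subseteq> C - {a}" "X' \<subseteq> C - {a}" and YC: "Y \<subseteq> ?S - C" "Y' \<subseteq> ?S - C"
    using XY by auto
  have rel: "zero_sum ?Z"
    using eq XC YC C_S by (intro zero_sum_of_equal_sums) auto
  have evenZ: "even (card ?Z)"
    using card_sym_diff[of "X \<union> Y" "X' \<union> Y'"] eq(2) by (metis even_add even_mult_iff even_numeral finite)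
  have Z: "?Z = ?P \<union> ?R" and Z': "sym_diff C ?Z = (C - ?P) \<union> ?R" and "?P \<inter> ?R = {}" "?P \<subseteq> C - {a}" "C \<inter> ?R = {}"
    using XC YC by blast+
  have "card Y \<le> 1" "card Y' \<le> 1" using XY by auto
  then have R: "card ?R \<le> 2" using card_sym_diff[of Y Y'] by simp
  show False
  proof (cases "card ?P \<le> 3")
    case True
    have "card ?Z \<le> card ?P + card ?R" unfolding Z by (rule card_Un_le)
    then have "card ?Z \<le> 5" using R True by simp
    moreover have "?Z \<noteq> {}" unfolding Z using XY by auto
    ultimately show False using zero_sum_even_card[OF rel evenZ] by simp
  next
    case False
    \<comment> \<open>More than three points of \<open>C\<close> are involved, so passing to the complement inside \<open>C\<close> leaves at
      most two of them.\<close>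
    let ?Z' = "sym_diff C ?Z"
    have "card (C - ?P) = 6 - card ?P"
      using \<open>?P \<subseteq> C - {a}\<close> C by (subst card_Diff_subset) auto
    moreover have "card ?Z' \<le> card (C - ?P) + card ?R" unfolding Z' by (rule card_Un_le)
    ultimately have "card ?Z' \<le> 4" using R False by simp
    moreover have "a \<in> ?Z'" unfolding Z' using a \<open>?P \<subseteq> C - {a}\<close> by blast
    moreover have "even (card ?Z')"
      using card_sym_diff[of C ?Z] evenZ C by (metis even_add even_mult_iff even_numeral finite)
    ultimately show False
      using zero_sum_even_card[OF zero_sum_sym_diff[OF C(1) rel]] by fastforce
  qed
qed

end

section \<open>Almost perfect nonlinear functions\<close>

text \<open>Otherwise \<open>x\<close>, \<open>y\<close> and \<open>z\<close> are solutions of one derivative equation in direction \<open>x + y\<close>.\<close>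

lemma apn_flat_sum:
  assumes "apn F" "x \<noteq> y" "x \<noteq> z" "y \<noteq> z"
  shows "F x + F y + F z \<noteq> F (x + y + z)"
proof
  assume eq: "F x + F y + F z = F (x + y + z)"
  let ?S = "{t. F t + F (t + (x + y)) = F x + F y}"
  have "F z + F (z + (x + y)) = F x + F y"
    using eq by (simp add: ac_simps bit_vec_swap)
  then have "{x, y, z} \<subseteq> ?S"
    by (auto simp: ac_simps)
  then have "card {x, y, z} \<le> card ?S" by (intro card_mono) auto
  moreover have "x + y \<noteq> 0" using assms by simp
  then have "card ?S \<le> 2" using assms(1) unfolding apn_def by blast
  ultimately show False using assms by simp
qed

text \<open>Adding the affine function times \<open>y0\<close> moves the graph into a hyperplane. At \<open>p\<close> and \<open>q\<close>,
  where this may fail, the values are replaced by \<open>0\<close> and \<open>c\<close>. Pairing \<open>x\<close> with \<open>x + p + q\<close> shows that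
  the derivative in direction \<open>p + q\<close> has at most \<open>Q / 2 - 1\<close> values on the other points, fewer than the
  hyperplane has vectors, so \<open>c\<close> can be chosen outside them.\<close>

lemma punctured_sidon_graph_of_apn:
  fixes F :: "bit ^ 'n \<Rightarrow> bit ^ 'n"
  assumes apn: "apn F" and v: "v \<noteq> 0" and pq: "p \<noteq> q"
    and aff: "\<And>x. x \<notin> {p, q} \<Longrightarrow> dot v (F x) = dot u x + b"
  shows "\<exists>G. punctured_sidon_graph G v p q (2 ^ CARD('n))"
proof -
  obtain y0 where "dot y0 v = 1"
    using ex_dot_eq_1[OF v] by blast
  then have y0: "dot v y0 = 1" by (simp add: dot_commute)
  let ?e = "p + q"
  define G1 where "G1 x = F x + (dot u x + b) *s y0" for x
  have dot_G1: "dot v (G1 x) = 0" if "x \<notin> {p, q}" for x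
    unfolding G1_def dot_add_right dot_scale_right y0 aff[OF that] by simp
  have G1_flat: "G1 x + G1 y + G1 z \<noteq> G1 (x + y + z)" if "x \<noteq> y" "x \<noteq> z" "y \<noteq> z" for x y z
  proof -
    have "dot u (x + y + z) + b = (dot u x + b) + (dot u y + b) + (dot u z + b)"
      unfolding dot_add_right
      by (cases b; cases "dot u x"; cases "dot u y"; cases "dot u z") simp_all
    then have "G1 (x + y + z) = F (x + y + z) + ((dot u x + b) *s y0 + (dot u y + b) *s y0 + (dot u z + b) *s y0)"
      unfolding G1_def by (simp only: vec.scale_left_distrib)
    then show ?thesis
      using apn_flat_sum[OF apn that] by (auto simp: G1_def ac_simps)
  qed
  define H where "H = {z. dot v z = 0}"
  have card_H: "2 * card H = CARD(bit ^ 'n)"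
    unfolding H_def using v by (rule card_hyperplane)
  have "\<exists>c\<in>H. \<forall>x. x \<notin> {p, q} \<longrightarrow> G1 x + G1 (x + ?e) \<noteq> c"
  proof (rule ccontr)
    let ?A = "UNIV - {p, q}"
    let ?D = "\<lambda>x. G1 x + G1 (x + ?e)"
    assume "\<not> ?thesis"
    then have onto: "\<forall>c\<in>H. \<exists>x\<in>?A. ?D x = c" by blast
    have "2 \<le> card {x \<in> ?A. ?D x = c}" if c: "c \<in> H" for c
    proof -
      obtain x where x: "x \<in> ?A" "?D x = c" using onto c by blast
      then have "{x, x + ?e} \<subseteq> {x \<in> ?A. ?D x = c}"
        by (auto simp: ac_simps bit_vec_swap)
      then have "card {x, x + ?e} \<le> card {x \<in> ?A. ?D x = c}" by (intro card_mono) auto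
      moreover have "x \<noteq> x + ?e" using pq by (metis bit_vec_add_eq_0_iff bit_vec_add_left_self bit_vec_add_self)
      ultimately show ?thesis by simp
    qed
    then have "(\<Sum>c\<in>H. 2) \<le> (\<Sum>c\<in>H. card {x \<in> ?A. ?D x = c})"
      by (intro sum_mono)
    also have "\<dots> = card (\<Union>c\<in>H. {x \<in> ?A. ?D x = c})"
      by (subst card_UN_disjoint) auto
    also have "\<dots> \<le> card ?A" by (intro card_mono) auto
    also have "\<dots> = CARD(bit ^ 'n) - 2"
      using pq by (subst card_Diff_subset) auto
    finally have "2 * card H \<le> CARD(bit ^ 'n) - 2" by simp
    moreover have "0 < CARD(bit ^ 'n)" by simp
    ultimately show False using card_H by linarith
  qed
  then obtain c where c: "dot v c = 0" "\<And>x. x \<notin> {p, q} \<Longrightarrow> G1 x + G1 (x + ?e) \<noteq> c"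
    by (auto simp: H_def)
  define G where "G x = (if x = p then 0 else if x = q then c else G1 x)" for x
  have "punctured_sidon_graph G v p q (2 ^ CARD('n))"
  proof
    show "dot v (G x) = 0" for x
      using dot_G1 c by (auto simp: G_def)
    fix x y z
    assume ne: "x \<noteq> y" "x \<noteq> z" "y \<noteq> z" and eq: "G x + G y + G z = G (x + y + z)"
    let ?t = "x + y + z"
    have ne_t: "?t \<noteq> x" "?t \<noteq> y" "?t \<noteq> z"
      using ne by (auto simp: ac_simps bit_vec_swap)
    have "False" if "p \<notin> {x, y, z, ?t}" "q \<notin> {x, y, z, ?t}"
      using that eq G1_flat[OF ne] by (auto simp: G_def)
    moreover have "False" if p: "p \<in> {x, y, z, ?t}" and q: "q \<in> {x, y, z, ?t}"
    proof -
      \<comment> \<open>If two of the four points are \<open>p\<close> and \<open>q\<close>, the other two differ by \<open>p + q\<close> and their derivative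
        value would be \<open>c\<close>.\<close>
      have opposite: False
        if ij: "{i, j} = {p, q}" and k: "k \<noteq> i" "k \<noteq> j" and l: "l = k + (i + j)"
          and sum: "G i + G j + (G k + G l) = 0" for i j k l
      proof -
        have "i + j = ?e" "G i + G j = c"
          using ij pq by (auto simp: doubleton_eq_iff G_def ac_simps)
        moreover have "k \<notin> {p, q}" using ij k by auto
        moreover from this have "k + ?e \<notin> {p, q}"
          by (auto simp: ac_simps bit_vec_swap)
        ultimately show False
          using c(2)[of k] l sum by (auto simp: G_def)
      qed
      have sum0: "G x + (G y + (G z + G ?t)) = 0"
        unfolding eq[symmetric] by (simp add: ac_simps)
      from p q pq consider "{x, y} = {p, q}" | "{x, z} = {p, q}" | "{x, ?t} = {p, q}"
        | "{y, z} = {p, q}" | "{y, ?t} = {p, q}" | "{z, ?t} = {p, q}"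
        by (elim insertE emptyE) (simp_all add: insert_commute)
      then show False
      proof cases
        case 1
        then show False by (rule opposite[of _ _ z ?t])
            (use ne ne_t sum0 in \<open>auto simp: ac_simps simp del: bit_vec_add_eq_0_iff\<close>)
      next
        case 2
        then show False by (rule opposite[of _ _ y ?t])
            (use ne ne_t sum0 in \<open>auto simp: ac_simps simp del: bit_vec_add_eq_0_iff\<close>)
      next
        case 3
        then show False by (rule opposite[of _ _ y z])
            (use ne ne_t sum0 in \<open>auto simp: ac_simps simp del: bit_vec_add_eq_0_iff\<close>)
      next
        case 4
        then show False by (rule opposite[of _ _ x ?t])
            (use ne ne_t sum0 in \<open>auto simp: ac_simps simp del: bit_vec_add_eq_0_iff\<close>)
      next
        case 5
        then show False by (rule opposite[of _ _ x z])
            (use ne ne_t sum0 in \<open>auto simp: ac_simps simp del: bit_vec_add_eq_0_iff\<close>)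
      next
        case 6
        then show False by (rule opposite[of _ _ x y])
            (use ne ne_t sum0 in \<open>auto simp: ac_simps simp del: bit_vec_add_eq_0_iff\<close>)
      qed
    qed
    ultimately show "(p \<in> {x, y, z, ?t}) \<noteq> (q \<in> {x, y, z, ?t})" by blast
  qed (use v pq in auto)
  then show ?thesis by blast
qed

lemma ex_pair_superset:
  assumes "card A \<le> 2" "finite A" "2 \<le> CARD('a)"
  shows "\<exists>p q :: 'a. p \<noteq> q \<and> A \<subseteq> {p, q}"
proof -
  have "finite (UNIV :: 'a set)" using assms(3) by (metis card.infinite not_numeral_le_zero)
  then obtain B where "A \<subseteq> B" "card B = 2"
    using exists_subset_between[of A 2 "UNIV :: 'a set"] assms by auto
  then show ?thesis by (auto simp: card_2_iff)
qed

theorem corollary4p3: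
  fixes F :: "bit ^ 'n \<Rightarrow> bit ^ 'n"
  assumes "CARD('n) \<ge> 4" and "even CARD('n)" and "apn F"
  shows "nonlinearity F \<ge> 3"
proof -
  have far: "3 \<le> hamming_dist (\<lambda>x. dot v (F x)) g" if v: "v \<noteq> 0" and g: "affine_fun g" for v g
  proof (rule ccontr)
    assume "\<not> ?thesis"
    then have "card {x. dot v (F x) \<noteq> g x} \<le> 2" by (simp add: hamming_dist_def)
    moreover have "2 \<le> CARD(bit ^ 'n)"
      using self_le_power[of 2 "CARD('n)"] by simp
    ultimately obtain p q where pq: "p \<noteq> q" "{x. dot v (F x) \<noteq> g x} \<subseteq> {p, q}"
      using ex_pair_superset[of "{x. dot v (F x) \<noteq> g x}"] by auto
    obtain u b where "g = (\<lambda>x. dot u x + b)"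
      using g by (auto simp: affine_fun_iff_dot)
    with pq have "dot v (F x) = dot u x + b" if "x \<notin> {p, q}" for x
      using that by blast
    then obtain G where G: "punctured_sidon_graph G v p q (2 ^ CARD('n))"
      using punctured_sidon_graph_of_apn[OF assms(3) v pq(1)] by metis
    from G have "CARD('n) \<noteq> 4" by (rule punctured_sidon_graph.dimension_neq_4)
    moreover have "CARD('n) \<noteq> 5" using assms(2) by auto
    ultimately have "6 \<le> CARD('n)" using assms(1) by linarith
    then show False using no_punctured_sidon_graph[OF G assms(2)] by blast
  qed
  have "\<exists>g :: bit ^ 'n \<Rightarrow> bit. affine_fun g"
    unfolding affine_fun_iff_dot by blast
  then have "3 \<le> nonlinearity_bool (\<lambda>x. dot v (F x))" if "v \<noteq> 0" for v
    unfolding nonlinearity_bool_def using far[OF that] by (subst Min_ge_iff) auto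
  moreover have "\<exists>v :: bit ^ 'n. v \<noteq> 0"
    by (metis (full_types) axis_eq_0_iff zero_neq_one)
  ultimately show ?thesis
    unfolding nonlinearity_def by (subst Min_ge_iff) auto
qed

end
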